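(* Abstract renaming is correct, complete and $\gamma$-complete with respect to concrete renaming: for every renaming $\rho$, $$\alpha_{\mathrm{Sh}}(\rho(\chi))=\rho(\alpha_{\mathrm{Sh}}(\chi))\quad\text{for all }\chi\in\mathtt{Psub},\qquad \gamma_{\mathrm{Sh}}(\rho(a))=\rho(\gamma_{\mathrm{Sh}}(a))\quad\text{for all }a\in\mathtt{Sharing}.$$
   Context: Fix a first-order signature with at least one constant and one function symbol of arity $\ge 2$, and an infinite set $\mathcal V$ of variables; $\wp_f$ denotes finite subsets. A substitution is a map $\theta$ from $\mathcal V$ to terms with finite $\mathrm{dom}(\theta)=\{x\mid\theta(x)\neq x\}$, extended to terms; $\mathrm{rng}(\theta)$ is the set of variables of the terms $\theta(x)$, $x\in\mathrm{dom}(\theta)$; $(\theta\circ\delta)(x)=\theta(\delta(x))$. $\mathit{ISubst}$ is the set of idempotent substitutions ($\mathrm{dom}\cap\mathrm{rng}=\emptyset$); a renaming is a substitution that is a bijection $\mathcal V\to\mathcal V$. For $U\in\wp_f(\mathcal V)$, $\theta_1\sim_U\theta_2$ iff there is a renaming $\rho$ with $\theta_1(u)=\rho(\theta_2(u))$ for all $u\in U$; $[\theta]_U$ is the $\sim_U$-class of $\theta\in\mathit{ISubst}$ and $\mathit{ISubst}_{\sim_U}$ the set of such classes. For a renaming $\rho$, $\rho([\sigma]_U)=[\rho\circ\sigma\circ\rho^{-1}]_{\rho(U)}$ (independent of the representative). Concrete domain: $\mathtt{Psub}=\{[\Theta,U]\mid\Theta\subseteq\mathit{ISubst}_{\sim_U},U\in\wp_f(\mathcal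 V)\}\cup\{\bot_{\mathrm{Ps}},\top_{\mathrm{Ps}}\}$, with bottom $\bot_{\mathrm{Ps}}$, top $\top_{\mathrm{Ps}}$, and $[\Theta_1,U_1]\sqsubseteq_{\mathrm{Ps}}[\Theta_2,U_2]$ iff $U_1=U_2$, $\Theta_1\subseteq\Theta_2$. Abstract domain: $\mathtt{Sharing}=\{[A,U]\mid A\subseteq\wp(U),(A\ne\emptyset\Rightarrow\emptyset\in A),U\in\wp_f(\mathcal V)\}\cup\{\bot_{\mathrm{Sh}},\top_{\mathrm{Sh}}\}$, ordered by $\sqsubseteq_{\mathrm{Sh}}$ in the same way. Abstraction: $\mathrm{occ}(\sigma,y)=\{z\in\mathcal V\mid y\in\mathrm{vars}(\sigma(z))\}$; $\alpha_{\mathrm{Sh}}([\sigma]_V)=[\{\mathrm{occ}(\sigma,y)\cap V\mid y\in\mathcal V\},V]$; $\alpha_{\mathrm{Sh}}(\bot_{\mathrm{Ps}})=\bot_{\mathrm{Sh}}$, $\alpha_{\mathrm{Sh}}(\top_{\mathrm{Ps}})=\top_{\mathrm{Sh}}$, and $\alpha_{\mathrm{Sh}}([\Theta,U])=[\bigcup_{[\sigma]_U\in\Theta}A_\sigma,U]$, where $\alpha_{\mathrm{Sh}}([\sigma]_U)=[A_\sigma,U]$ (so $\alpha_{\mathrm{Sh}}([\emptyset,U])=[\emptyset,U]$). Concretization: $\gamma_{\mathrm{Sh}}([S,U])=[\{[\theta]_U\mid\alpha_{\mathrm{Sh}}([\theta]_U)\sqsubseteq_{\mathrm{Sh}}[S,U]\},U]$,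 $\gamma_{\mathrm{Sh}}(\bot_{\mathrm{Sh}})=\bot_{\mathrm{Ps}}$, $\gamma_{\mathrm{Sh}}(\top_{\mathrm{Sh}})=\top_{\mathrm{Ps}}$. Renamings: concrete $\rho([\Theta,U])=[\{\rho(c)\mid c\in\Theta\},\rho(U)]$; abstract $\rho([A,U])=[\{\rho(B)\mid B\in A\},\rho(U)]$; both map bottom to bottom and top to top. *)

theory Defs
  imports Main
begin

text \<open>
  The signature is the type \<open>'f\<close> of function symbols together with an arity function
  \<open>ar\<close>; the variables are the elements of the type \<open>'v\<close>. \<open>vars t\<close> is the set of variables of
  the term \<open>t\<close>. The type also contains applications to the wrong number of arguments; \<open>wf_trm\<close> excludes
  these.
\<close>

datatype ('f, vars: 'v) trm = Var 'v | Fun 'f "('f, 'v) trm list"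

fun wf_trm :: "('f \<Rightarrow> nat) \<Rightarrow> ('f, 'v) trm \<Rightarrow> bool" where
  "wf_trm ar (Var x) \<longleftrightarrow> True"
| "wf_trm ar (Fun f ts) \<longleftrightarrow> length ts = ar f \<and> (\<forall>t\<in>set ts. wf_trm ar t)"

type_synonym ('f, 'v) sbst = "'v \<Rightarrow> ('f, 'v) trm"

definition sdom :: "('f, 'v) sbst \<Rightarrow> 'v set" where
  "sdom \<theta> = {x. \<theta> x \<noteq> Var x}"

definition srng :: "('f, 'v) sbst \<Rightarrow> 'v set" where
  "srng \<theta> = (\<Union>x\<in>sdom \<theta>. vars (\<theta> x))"

definition Subst :: "('f \<Rightarrow> nat) \<Rightarrow> ('f, 'v) sbst set" where
  "Subst ar = {\<theta>. (\<forall>x. wf_trm ar (\<theta> x)) \<and> finite (sdom \<theta>)}"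

primrec app :: "('f, 'v) sbst \<Rightarrow> ('f, 'v) trm \<Rightarrow> ('f, 'v) trm" where
  "app \<theta> (Var x) = \<theta> x"
| "app \<theta> (Fun f ts) = Fun f (map (app \<theta>) ts)"

definition scomp :: "('f, 'v) sbst \<Rightarrow> ('f, 'v) sbst \<Rightarrow> ('f, 'v) sbst" (infixl "\<circ>\<^sub>s" 75) where
  "\<theta> \<circ>\<^sub>s \<delta> = (\<lambda>x. app \<theta> (\<delta> x))"

definition ISubst :: "('f \<Rightarrow> nat) \<Rightarrow> ('f, 'v) sbst set" where
  "ISubst ar = {\<theta> \<in> Subst ar. sdom \<theta> \<inter> srng \<theta> = {}}"

definition renaming :: "('f \<Rightarrow> nat) \<Rightarrow> ('f, 'v) sbst \<Rightarrow> bool" where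
  "renaming ar \<rho> \<longleftrightarrow> \<rho> \<in> Subst ar \<and> bij_betw \<rho> UNIV (range Var)"

definition ren_inv :: "('f, 'v) sbst \<Rightarrow> ('f, 'v) sbst" where
  "ren_inv \<rho> = (\<lambda>x. Var (inv \<rho> (Var x)))"

definition ren_vars :: "('f, 'v) sbst \<Rightarrow> 'v set \<Rightarrow> 'v set" where
  "ren_vars \<rho> U = {y. Var y \<in> \<rho> ` U}"

definition sim :: "('f \<Rightarrow> nat) \<Rightarrow> 'v set \<Rightarrow> (('f, 'v) sbst \<times> ('f, 'v) sbst) set" where
  "sim ar U = {(\<theta>\<^sub>1, \<theta>\<^sub>2). \<theta>\<^sub>1 \<in> ISubst ar \<and> \<theta>\<^sub>2 \<in> ISubst ar \<and>
     (\<exists>\<rho>. renaming ar \<rho> \<and> (\<forall>u\<in>U. \<theta>\<^sub>1 u = app \<rho> (\<theta>\<^sub>2 u)))}"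

definition cls :: "('f \<Rightarrow> nat) \<Rightarrow> 'v set \<Rightarrow> ('f, 'v) sbst \<Rightarrow> ('f, 'v) sbst set" where
  "cls ar U \<theta> = sim ar U `` {\<theta>}"

abbreviation ISubst_sim :: "('f \<Rightarrow> nat) \<Rightarrow> 'v set \<Rightarrow> ('f, 'v) sbst set set" where
  "ISubst_sim ar U \<equiv> ISubst ar // sim ar U"

text \<open>
  Both domains consist of pairs \<open>[X, U]\<close> plus a bottom and a top element, with the same order:
  \<open>'e\<close> is the type of \<open>\<sim>\<^sub>U\<close>-classes in the concrete case and of sets of variables in the
  abstract case.
\<close>

datatype ('e, 'v) elt = Bot | Pr "'e set" "'v set" | Top

fun elt_le :: "('e, 'v) elt \<Rightarrow> ('e, 'v) elt \<Rightarrow> bool" (infix "\<sqsubseteq>" 50) where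
  "Bot \<sqsubseteq> b \<longleftrightarrow> True"
| "a \<sqsubseteq> Top \<longleftrightarrow> True"
| "Pr X U \<sqsubseteq> Pr Y V \<longleftrightarrow> U = V \<and> X \<subseteq> Y"
| "_ \<sqsubseteq> _ \<longleftrightarrow> False"

type_synonym ('f, 'v) psub = "(('f, 'v) sbst set, 'v) elt"
type_synonym 'v sharing = "('v set, 'v) elt"

definition Psub :: "('f \<Rightarrow> nat) \<Rightarrow> ('f, 'v) psub set" where
  "Psub ar = {Pr \<Theta> U |\<Theta> U. \<Theta> \<subseteq> ISubst_sim ar U \<and> finite U} \<union> {Bot, Top}"

definition Sharing :: "'v sharing set" where
  "Sharing = {Pr A U |A U. A \<subseteq> Pow U \<and> (A \<noteq> {} \<longrightarrow> {} \<in> A) \<and> finite U} \<union> {Bot, Top}"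

definition occ :: "('f, 'v) sbst \<Rightarrow> 'v \<Rightarrow> 'v set" where
  "occ \<sigma> y = {z. y \<in> vars (\<sigma> z)}"

definition sh_groups :: "'v set \<Rightarrow> ('f, 'v) sbst \<Rightarrow> 'v set set" where
  "sh_groups V \<sigma> = {occ \<sigma> y \<inter> V |y. True}"

text \<open>
  A function given on representatives is lifted to classes as the unique element of the image of
  the class; the lemmas \<open>cls_sh_groups_cls\<close> and \<open>ren_cls_cls\<close> below state that these lifted
  functions take the intended value on the class of every representative.
\<close>

definition cls_sh_groups :: "'v set \<Rightarrow> ('f, 'v) sbst set \<Rightarrow> 'v set set" where
  "cls_sh_groups V c = the_elem (sh_groups V ` c)"

definition alpha_cls :: "'v set \<Rightarrow> ('f, 'v) sbst set \<Rightarrow> 'v sharing" where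
  "alpha_cls V c = Pr (cls_sh_groups V c) V"

fun alpha :: "('f, 'v) psub \<Rightarrow> 'v sharing" where
  "alpha Bot = Bot"
| "alpha Top = Top"
| "alpha (Pr \<Theta> U) = Pr (\<Union>c\<in>\<Theta>. cls_sh_groups U c) U"

fun gamma :: "('f \<Rightarrow> nat) \<Rightarrow> 'v sharing \<Rightarrow> ('f, 'v) psub" where
  "gamma ar Bot = Bot"
| "gamma ar Top = Top"
| "gamma ar (Pr S U) = Pr {c \<in> ISubst_sim ar U. alpha_cls U c \<sqsubseteq> Pr S U} U"

definition ren_cls :: "('f \<Rightarrow> nat) \<Rightarrow> ('f, 'v) sbst \<Rightarrow> 'v set \<Rightarrow> ('f, 'v) sbst set \<Rightarrow> ('f, 'v) sbst set" where
  "ren_cls ar \<rho> U c = the_elem ((\<lambda>\<sigma>. cls ar (ren_vars \<rho> U) (\<rho> \<circ>\<^sub>s \<sigma> \<circ>\<^sub>s ren_inv \<rho>)) ` c)"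

fun ren_psub :: "('f \<Rightarrow> nat) \<Rightarrow> ('f, 'v) sbst \<Rightarrow> ('f, 'v) psub \<Rightarrow> ('f, 'v) psub" where
  "ren_psub ar \<rho> Bot = Bot"
| "ren_psub ar \<rho> Top = Top"
| "ren_psub ar \<rho> (Pr \<Theta> U) = Pr (ren_cls ar \<rho> U ` \<Theta>) (ren_vars \<rho> U)"

fun ren_sharing :: "('f, 'v) sbst \<Rightarrow> 'v sharing \<Rightarrow> 'v sharing" where
  "ren_sharing \<rho> Bot = Bot"
| "ren_sharing \<rho> Top = Top"
| "ren_sharing \<rho> (Pr A U) = Pr (ren_vars \<rho> ` A) (ren_vars \<rho> U)"

lemma renaming_obtain:
  assumes "renaming ar \<rho>"
  obtains f where "bij f" "\<rho> = (\<lambda>x. Var (f x))"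
proof -
  have b: "bij_betw \<rho> UNIV (range Var)" using assms by (simp add: renaming_def)
  then have "\<forall>x. \<exists>y. \<rho> x = Var y" by (auto simp: bij_betw_def)
  then obtain f where f: "\<And>x. \<rho> x = Var (f x)" by metis
  have "inj f" using b f by (auto simp: bij_betw_def inj_on_def)
  moreover have "surj f"
  proof -
    have "\<exists>x. y = f x" for y
    proof -
      have "Var y \<in> range \<rho>" using b by (auto simp: bij_betw_def)
      then show ?thesis using f by auto
    qed
    then show ?thesis by (simp add: surj_def)
  qed
  ultimately show ?thesis using that f by (auto simp: bij_def)
qed

lemma renamingI:
  fixes ar :: "'f \<Rightarrow> nat" and f :: "'v \<Rightarrow> 'v"
  assumes "bij f" "finite {x. f x \<noteq> x}"
  shows "renaming ar (\<lambda>x. Var (f x))"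
proof -
  have "range (\<lambda>x. Var (f x) :: ('f, 'v) trm) = Var ` range f" by (rule image_image[symmetric])
  then have "bij_betw (\<lambda>x. Var (f x) :: ('f, 'v) trm) UNIV (range Var)"
    using assms(1) by (simp add: bij_betw_def inj_on_def)
  then show ?thesis using assms(2) by (simp add: renaming_def Subst_def sdom_def)
qed

lemma renaming_finite:
  "renaming ar (\<lambda>x. Var (f x)) \<Longrightarrow> finite {x. f x \<noteq> x}"
  by (simp add: renaming_def Subst_def sdom_def)

lemma app_ren: "app (\<lambda>x. Var (f x)) t = map_trm id f t"
  by (induction t) simp_all

lemma ren_vars_ren: "ren_vars (\<lambda>x. Var (f x)) U = f ` U"
  by (auto simp: ren_vars_def)

lemma ren_inv_ren: "bij f \<Longrightarrow> ren_inv (\<lambda>x. Var (f x)) = (\<lambda>x. Var (inv f x))"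
  unfolding ren_inv_def
proof (rule ext)
  fix x assume b: "bij f"
  have "inv (\<lambda>x. Var (f x)) (Var x) = inv f x"
    by (rule inv_f_eq) (use b in \<open>auto simp: inj_on_def bij_def surj_f_inv_f\<close>)
  then show "Var (inv (\<lambda>x. Var (f x)) (Var x)) = Var (inv f x)" by simp
qed

lemma conj_ren:
  assumes "bij f" "\<rho> = (\<lambda>x. Var (f x))"
  shows "\<rho> \<circ>\<^sub>s \<sigma> \<circ>\<^sub>s ren_inv \<rho> = (\<lambda>x. map_trm id f (\<sigma> (inv f x)))"
  by (simp add: assms ren_inv_ren scomp_def app_ren)

lemma finite_inv_support:
  assumes "bij f" "finite {x. f x \<noteq> x}"
  shows "finite {x. inv f x \<noteq> x}"
proof -
  have "{x. inv f x \<noteq> x} = {x. f x \<noteq> x}"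
    using bij_inv_eq_iff[OF assms(1)] by (intro Collect_cong) (simp add: eq_commute)
  then show ?thesis using assms(2) by (simp only:)
qed

lemma simI:
  "renaming ar \<rho> \<Longrightarrow> \<sigma> \<in> ISubst ar \<Longrightarrow> \<tau> \<in> ISubst ar \<Longrightarrow>
    (\<And>u. u \<in> U \<Longrightarrow> \<sigma> u = app \<rho> (\<tau> u)) \<Longrightarrow> (\<sigma>, \<tau>) \<in> sim ar U"
  unfolding sim_def by blast

lemma equiv_sim:
  fixes ar :: "'f \<Rightarrow> nat" and U :: "'v set"
  shows "equiv (ISubst ar) (sim ar U)"
proof (rule equivI)
  show "sim ar U \<subseteq> ISubst ar \<times> ISubst ar" by (auto simp: sim_def)
  show "refl_on (ISubst ar) (sim ar U)"
  proof (rule refl_onI)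
    fix a :: "('f, 'v) sbst"
    assume "a \<in> ISubst ar"
    moreover have "renaming ar (\<lambda>x. Var (id x))" by (rule renamingI) (simp_all only: bij_id, simp)
    moreover have "a u = app (\<lambda>x. Var (id x)) (a u)" for u
      unfolding app_ren by (simp only: trm.map_id)
    ultimately show "(a, a) \<in> sim ar U" by (intro simI)
  qed
  show "sym (sim ar U)"
  proof (rule symI)
    fix a b assume "(a, b) \<in> sim ar U"
    then obtain \<rho> where r: "renaming ar \<rho>" "a \<in> ISubst ar" "b \<in> ISubst ar"
      "\<And>u. u \<in> U \<Longrightarrow> a u = app \<rho> (b u)" by (auto simp: sim_def)
    obtain f where f: "bij f" "\<rho> = (\<lambda>x. Var (f x))" by (rule renaming_obtain[OF r(1)])
    have "renaming ar (\<lambda>x. Var (inv f x))"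
      by (intro renamingI bij_imp_bij_inv finite_inv_support f(1)
          renaming_finite[OF r(1)[unfolded f(2)]])
    moreover have "inv f \<circ> f = id" using f(1) by (simp add: bij_def)
    then have "b u = app (\<lambda>x. Var (inv f x)) (a u)" if "u \<in> U" for u
      unfolding r(4)[OF that] f(2) app_ren trm.map_comp by (simp add: trm.map_id)
    ultimately show "(b, a) \<in> sim ar U" using r(2,3) by (intro simI)
  qed
  show "trans (sim ar U)"
  proof (rule transI)
    fix a b c assume "(a, b) \<in> sim ar U" "(b, c) \<in> sim ar U"
    then obtain \<rho> \<delta> where r: "renaming ar \<rho>" "renaming ar \<delta>" "a \<in> ISubst ar" "c \<in> ISubst ar"
      "\<And>u. u \<in> U \<Longrightarrow> a u = app \<rho> (b u)" "\<And>u. u \<in> U \<Longrightarrow> b u = app \<delta> (c u)"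
      by (auto simp: sim_def)
    obtain f where f: "bij f" "\<rho> = (\<lambda>x. Var (f x))" by (rule renaming_obtain[OF r(1)])
    obtain g where g: "bij g" "\<delta> = (\<lambda>x. Var (g x))" by (rule renaming_obtain[OF r(2)])
    have "{x. (f \<circ> g) x \<noteq> x} \<subseteq> {x. f x \<noteq> x} \<union> {x. g x \<noteq> x}" by auto
    moreover have "finite ({x. f x \<noteq> x} \<union> {x. g x \<noteq> x})"
      using renaming_finite[OF r(1)[unfolded f(2)]] renaming_finite[OF r(2)[unfolded g(2)]] by simp
    ultimately have "finite {x. (f \<circ> g) x \<noteq> x}" using finite_subset by blast
    then have "renaming ar (\<lambda>x. Var ((f \<circ> g) x))" by (intro renamingI bij_comp f g)
    moreover have "a u = app (\<lambda>x. Var ((f \<circ> g) x)) (c u)" if "u \<in> U" for u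
      unfolding r(5,6)[OF that] f(2) g(2) app_ren trm.map_comp by (simp only: id_o)
    ultimately show "(a, c) \<in> sim ar U" using r(3,4) by (intro simI)
  qed
qed

lemma cls_self: "\<sigma> \<in> ISubst ar \<Longrightarrow> \<sigma> \<in> cls ar U \<sigma>"
  unfolding cls_def by (rule equiv_class_self[OF equiv_sim])

lemma the_elem_image_const:
  "x \<in> c \<Longrightarrow> (\<And>y. y \<in> c \<Longrightarrow> g y = g x) \<Longrightarrow> the_elem (g ` c) = g x"
  by (rule the_elem_image_unique) blast+

lemma vars_map_trm: "vars (map_trm id f t) = f ` vars t"
  by (simp add: trm.set_map)

lemma sh_groups_sim:
  assumes "(\<sigma>, \<tau>) \<in> sim ar U"
  shows "sh_groups U \<tau> = sh_groups U \<sigma>"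
proof -
  obtain \<rho> where r: "renaming ar \<rho>" "\<And>u. u \<in> U \<Longrightarrow> \<sigma> u = app \<rho> (\<tau> u)"
    using assms by (auto simp: sim_def)
  obtain f where f: "bij f" "\<rho> = (\<lambda>x. Var (f x))" by (rule renaming_obtain[OF r(1)])
  have "vars (\<sigma> u) = f ` vars (\<tau> u)" if "u \<in> U" for u
    unfolding r(2)[OF that] f(2) app_ren by (rule vars_map_trm)
  moreover have "f y \<in> f ` A \<longleftrightarrow> y \<in> A" for y A
    using f(1) by (auto simp: bij_def inj_on_def)
  ultimately have "occ \<sigma> (f y) \<inter> U = occ \<tau> y \<inter> U" for y
    unfolding occ_def by blast
  then have "sh_groups U \<tau> = (\<lambda>y. occ \<sigma> (f y) \<inter> U) ` UNIV"
    by (simp add: sh_groups_def full_SetCompr_eq)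
  also have "\<dots> = (\<lambda>y. occ \<sigma> y \<inter> U) ` range f"
    by (rule image_image[symmetric])
  also have "\<dots> = sh_groups U \<sigma>"
    using f(1) by (simp add: sh_groups_def full_SetCompr_eq bij_is_surj)
  finally show ?thesis .
qed

lemma cls_sh_groups_cls:
  "\<sigma> \<in> ISubst ar \<Longrightarrow> cls_sh_groups U (cls ar U \<sigma>) = sh_groups U \<sigma>"
  unfolding cls_sh_groups_def
  by (rule the_elem_image_const[OF cls_self]) (assumption, unfold cls_def, erule ImageE, simp only: singleton_iff, erule sh_groups_sim)

lemma wf_map_trm: "wf_trm ar t \<Longrightarrow> wf_trm ar (map_trm id f t)"
  by (induction t) auto

lemma conj_ISubst:
  assumes "renaming ar \<rho>" "\<sigma> \<in> ISubst ar"
  shows "\<rho> \<circ>\<^sub>s \<sigma> \<circ>\<^sub>s ren_inv \<rho> \<in> ISubst ar"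
proof -
  obtain f where f: "bij f" "\<rho> = (\<lambda>x. Var (f x))" by (rule renaming_obtain[OF assms(1)])
  let ?t = "\<lambda>x. map_trm id f (\<sigma> (inv f x))"
  have i: "inv f (f x) = x" "f (inv f x) = x" for x
    using f(1) by (simp_all add: bij_def surj_f_inv_f)
  have eq: "map_trm id f t = Var (f x) \<longleftrightarrow> t = Var x" for t x
    using f(1) by (cases t) (auto simp: bij_def inj_on_def)
  have d: "sdom ?t = f ` sdom \<sigma>"
  proof (intro equalityI subsetI)
    fix x assume "x \<in> sdom ?t"
    then have "inv f x \<in> sdom \<sigma>" using eq[of _ "inv f x"] by (auto simp: sdom_def i)
    then show "x \<in> f ` sdom \<sigma>" by (metis i(2) imageI)
  next
    fix x assume "x \<in> f ` sdom \<sigma>"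
    then show "x \<in> sdom ?t" by (auto simp: sdom_def i eq)
  qed
  have "srng ?t = f ` srng \<sigma>"
    by (auto simp: srng_def d vars_map_trm i)
  then have "sdom ?t \<inter> srng ?t = f ` (sdom \<sigma> \<inter> srng \<sigma>)"
    using f(1) d by (simp add: image_Int bij_def)
  then show ?thesis
    unfolding conj_ren[OF f] using assms(2) d by (auto simp: ISubst_def Subst_def wf_map_trm)
qed

lemma conj_sim:
  assumes r: "renaming ar \<rho>" and s: "(\<sigma>, \<tau>) \<in> sim ar U"
  shows "(\<rho> \<circ>\<^sub>s \<sigma> \<circ>\<^sub>s ren_inv \<rho>, \<rho> \<circ>\<^sub>s \<tau> \<circ>\<^sub>s ren_inv \<rho>) \<in> sim ar (ren_vars \<rho> U)"
proof -
  obtain f where f: "bij f" "\<rho> = (\<lambda>x. Var (f x))" by (rule renaming_obtain[OF r])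
  obtain \<delta> where d: "renaming ar \<delta>" "\<And>u. u \<in> U \<Longrightarrow> \<sigma> u = app \<delta> (\<tau> u)"
    and m: "\<sigma> \<in> ISubst ar" "\<tau> \<in> ISubst ar"
    using s by (auto simp: sim_def)
  obtain g where g: "bij g" "\<delta> = (\<lambda>x. Var (g x))" by (rule renaming_obtain[OF d(1)])
  let ?h = "f \<circ> g \<circ> inv f"
  have i: "inv f (f x) = x" "f (inv f x) = x" for x
    using f(1) by (simp_all add: bij_def surj_f_inv_f)
  have "bij ?h" using f(1) g(1) by (intro bij_comp bij_imp_bij_inv)
  moreover have "{x. ?h x \<noteq> x} \<subseteq> f ` {x. g x \<noteq> x}"
  proof
    fix x assume "x \<in> {x. ?h x \<noteq> x}"
    then have "g (inv f x) \<noteq> inv f x" by (auto simp: i)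
    then show "x \<in> f ` {x. g x \<noteq> x}" by (metis (mono_tags) i(2) imageI mem_Collect_eq)
  qed
  then have "finite {x. ?h x \<noteq> x}" 
    using renaming_finite[OF d(1)[unfolded g(2)]] finite_subset by blast
  ultimately have "renaming ar (\<lambda>x. Var (?h x))" by (rule renamingI)
  moreover have "?h \<circ> f = f \<circ> g" by (auto simp: i)
  then have "map_trm id f (\<sigma> u) = app (\<lambda>x. Var (?h x)) (map_trm id f (\<tau> u))" if "u \<in> U" for u
    unfolding app_ren d(2)[OF that] g(2) trm.map_comp by (simp only:)
  then have "\<forall>v\<in>f ` U. map_trm id f (\<sigma> (inv f v)) =
      app (\<lambda>x. Var (?h x)) (map_trm id f (\<tau> (inv f v)))"
    by (auto simp only: i)
  ultimately show ?thesis
    using conj_ISubst[OF r m(1)] conj_ISubst[OF r m(2)]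
    unfolding conj_ren[OF f] unfolding f(2) ren_vars_ren by (intro simI) blast+
qed

lemma ren_cls_cls:
  assumes "renaming ar \<rho>" "\<sigma> \<in> ISubst ar"
  shows "ren_cls ar \<rho> U (cls ar U \<sigma>) = cls ar (ren_vars \<rho> U) (\<rho> \<circ>\<^sub>s \<sigma> \<circ>\<^sub>s ren_inv \<rho>)"
  unfolding ren_cls_def
proof (rule the_elem_image_const[OF cls_self])
  fix \<tau> assume "\<tau> \<in> cls ar U \<sigma>"
  then have "(\<rho> \<circ>\<^sub>s \<sigma> \<circ>\<^sub>s ren_inv \<rho>, \<rho> \<circ>\<^sub>s \<tau> \<circ>\<^sub>s ren_inv \<rho>) \<in> sim ar (ren_vars \<rho> U)"
    using conj_sim[OF assms(1)] by (simp add: cls_def)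
  then show "cls ar (ren_vars \<rho> U) (\<rho> \<circ>\<^sub>s \<tau> \<circ>\<^sub>s ren_inv \<rho>) =
      cls ar (ren_vars \<rho> U) (\<rho> \<circ>\<^sub>s \<sigma> \<circ>\<^sub>s ren_inv \<rho>)"
    unfolding cls_def by (metis equiv_class_eq equiv_sim)
qed (rule assms(2))

end

theory Submission
  imports Defs
begin

text \<open>
  Writing \<open>\<rho> x = Var (f x)\<close> with \<open>f\<close> bijective, \<open>occ\<close> of the conjugate of \<open>\<sigma>\<close> by \<open>\<rho>\<close> at \<open>f y\<close> is
  the \<open>f\<close>-image of \<open>occ \<sigma> y\<close>. Hence abstraction commutes with renaming on single classes, and
  correctness and completeness follow by taking unions. For \<open>\<gamma>\<close>-completeness, conjugation by
  \<open>\<rho>\<inverse>\<close> shows moreover that renaming maps the \<open>\<sim>\<^sub>U\<close>-classes onto the \<open>\<sim>\<^bsub>\<rho>(U)\<^esub>\<close>-classes, and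
  injectivity of \<open>f\<close> makes the abstract renaming reflect the order.
\<close>

lemma renaming_ren_inv:
  assumes "renaming ar \<rho>"
  shows "renaming ar (ren_inv \<rho>)"
proof -
  obtain f where f: "bij f" "\<rho> = (\<lambda>x. Var (f x))" by (rule renaming_obtain[OF assms])
  show ?thesis
    unfolding f(2) ren_inv_ren[OF f(1)]
    by (intro renamingI bij_imp_bij_inv finite_inv_support f(1)
        renaming_finite[OF assms[unfolded f(2)]])
qed

text \<open>Conjugation by \<open>ren_inv \<rho>\<close> undoes conjugation by
  \<open>\<rho>\<close>; this supplies preimages when renaming of classes is shown to be
  onto.\<close>

lemma conj_ren_inv:
  assumes "renaming ar \<rho>"
  shows "\<rho> \<circ>\<^sub>s (ren_inv \<rho> \<circ>\<^sub>s \<sigma> \<circ>\<^sub>s ren_inv (ren_inv \<rho>)) \<circ>\<^sub>s ren_inv \<rho> = \<sigma>"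
proof -
  obtain f where f: "bij f" "\<rho> = (\<lambda>x. Var (f x))" by (rule renaming_obtain[OF assms])
  have "f \<circ> inv f = id"
    using f(1) by (simp add: bij_is_surj flip: surj_iff)
  moreover have "ren_inv \<rho> = (\<lambda>x. Var (inv f x))"
    unfolding f(2) by (rule ren_inv_ren[OF f(1)])
  ultimately show ?thesis
    unfolding conj_ren[OF f] using f(1)
    by (simp add: conj_ren[OF bij_imp_bij_inv] inv_inv_eq trm.map_comp trm.map_id bij_is_surj surj_f_inv_f)
qed

lemma sh_groups_conj:
  assumes "renaming ar \<rho>"
  shows "sh_groups (ren_vars \<rho> U) (\<rho> \<circ>\<^sub>s \<sigma> \<circ>\<^sub>s ren_inv \<rho>) = ren_vars \<rho> ` sh_groups U \<sigma>"
proof -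
  obtain f where f: "bij f" "\<rho> = (\<lambda>x. Var (f x))" by (rule renaming_obtain[OF assms])
  let ?t = "\<lambda>x. map_trm id f (\<sigma> (inv f x))"
  have inj: "inj f" and surj: "surj f" using f(1) by (simp_all add: bij_def)
  have occ: "occ ?t (f y) = f ` occ \<sigma> y" for y
  proof -
    have "occ ?t (f y) = inv f -` occ \<sigma> y"
      by (auto simp: occ_def vars_map_trm inj_image_mem_iff[OF inj])
    also have "\<dots> = f ` occ \<sigma> y"
      using f(1) by (simp add: bij_vimage_eq_inv_image bij_imp_bij_inv inv_inv_eq)
    finally show ?thesis .
  qed
  \<comment> \<open>By surjectivity every index has the form \<open>f y\<close>, so the formula
    \<open>occ\<close> covers all sharing groups.\<close>
  have "sh_groups (f ` U) ?t = (\<lambda>y. occ ?t y \<inter> f ` U) ` range f"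
    by (simp add: sh_groups_def full_SetCompr_eq surj)
  also have "\<dots> = (`) f ` sh_groups U \<sigma>"
    by (simp add: sh_groups_def full_SetCompr_eq image_image occ image_Int[OF inj])
  finally show ?thesis
    unfolding conj_ren[OF f] unfolding f(2) ren_vars_ren[abs_def] .
qed

lemma ISubst_simE:
  assumes "c \<in> ISubst_sim ar U"
  obtains \<sigma> where "\<sigma> \<in> ISubst ar" "c = cls ar U \<sigma>"
  using assms unfolding cls_def by (rule quotientE)

lemma cls_in_ISubst_sim: "\<sigma> \<in> ISubst ar \<Longrightarrow> cls ar U \<sigma> \<in> ISubst_sim ar U"
  unfolding cls_def by (rule quotientI)

lemma cls_sh_groups_ren_cls:
  assumes "renaming ar \<rho>" "c \<in> ISubst_sim ar U"
  shows "cls_sh_groups (ren_vars \<rho> U) (ren_cls ar \<rho> U c) = ren_vars \<rho> ` cls_sh_groups U c"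
proof -
  obtain \<sigma> where "\<sigma> \<in> ISubst ar" "c = cls ar U \<sigma>" using assms(2) by (rule ISubst_simE)
  then show ?thesis
    using assms(1) by (simp add: ren_cls_cls cls_sh_groups_cls conj_ISubst sh_groups_conj)
qed

lemma ren_cls_image_ISubst_sim:
  assumes "renaming ar \<rho>"
  shows "ren_cls ar \<rho> U ` ISubst_sim ar U = ISubst_sim ar (ren_vars \<rho> U)"
proof (intro equalityI subsetI)
  fix d assume "d \<in> ren_cls ar \<rho> U ` ISubst_sim ar U"
  then show "d \<in> ISubst_sim ar (ren_vars \<rho> U)"
    by (auto elim!: ISubst_simE simp: ren_cls_cls assms conj_ISubst intro!: cls_in_ISubst_sim)
next
  fix d assume "d \<in> ISubst_sim ar (ren_vars \<rho> U)"
  then obtain \<sigma> where \<sigma>: "\<sigma> \<in> ISubst ar" "d = cls ar (ren_vars \<rho> U) \<sigma>" by (rule ISubst_simE)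
  \<comment> \<open>Conjugating back gives a representative of the preimage class.\<close>
  let ?\<tau> = "ren_inv \<rho> \<circ>\<^sub>s \<sigma> \<circ>\<^sub>s ren_inv (ren_inv \<rho>)"
  have "?\<tau> \<in> ISubst ar" by (intro conj_ISubst renaming_ren_inv assms \<sigma>(1))
  moreover from this have "d = ren_cls ar \<rho> U (cls ar U ?\<tau>)"
    using assms by (simp add: ren_cls_cls conj_ren_inv \<sigma>(2))
  ultimately show "d \<in> ren_cls ar \<rho> U ` ISubst_sim ar U"
    by (auto intro: cls_in_ISubst_sim)
qed

text \<open>Allows \<open>ren_vars \<rho>\<close> to be cancelled from both sides of an inclusion
  between sets of sharing groups.\<close>

lemma inj_ren_vars:
  assumes "renaming ar \<rho>"
  shows "inj (ren_vars \<rho>)"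
proof -
  obtain f where f: "bij f" "\<rho> = (\<lambda>x. Var (f x))" by (rule renaming_obtain[OF assms])
  show ?thesis
    unfolding f(2) ren_vars_ren[abs_def] using f(1) by (simp add: bij_is_inj inj_on_image)
qed

lemma alpha_ren_psub:
  assumes "renaming ar \<rho>" "\<chi> \<in> Psub ar"
  shows "alpha (ren_psub ar \<rho> \<chi>) = ren_sharing \<rho> (alpha \<chi>)"
proof (cases \<chi>)
  case (Pr \<Theta> U)
  then have "c \<in> ISubst_sim ar U" if "c \<in> \<Theta>" for c
    using assms(2) that by (auto simp: Psub_def)
  then show ?thesis
    by (simp add: Pr image_UN cls_sh_groups_ren_cls[OF assms(1)])
qed simp_all

lemma gamma_ren_sharing:
  assumes "renaming ar \<rho>"
  shows "gamma ar (ren_sharing \<rho> a) = ren_psub ar \<rho> (gamma ar a)"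
proof (cases a)
  case (Pr S U)
  have "alpha_cls (ren_vars \<rho> U) (ren_cls ar \<rho> U c) \<sqsubseteq> Pr (ren_vars \<rho> ` S) (ren_vars \<rho> U) \<longleftrightarrow>
      alpha_cls U c \<sqsubseteq> Pr S U" if "c \<in> ISubst_sim ar U" for c
    by (simp add: alpha_cls_def cls_sh_groups_ren_cls[OF assms that]
        inj_image_subset_iff[OF inj_ren_vars[OF assms]])
  then show ?thesis
    \<comment> \<open>Once the classes over \<open>ren_vars \<rho> U\<close> are written as images,
      both sides are the image of the same filtered set of classes.\<close>
    by (auto simp: Pr simp flip: ren_cls_image_ISubst_sim[OF assms])
qed simp_all

theorem theorem5p4:
  fixes ar :: "'f \<Rightarrow> nat" and \<rho> :: "('f, 'v) sbst"
  assumes "\<exists>f. ar f = 0" and "\<exists>f. ar f \<ge> 2"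
    and "infinite (UNIV :: 'v set)"
    and "renaming ar \<rho>"
  shows "(\<forall>\<chi> \<in> Psub ar. alpha (ren_psub ar \<rho> \<chi>) = ren_sharing \<rho> (alpha \<chi>)) \<and>
    (\<forall>a \<in> Sharing. gamma ar (ren_sharing \<rho> a) = ren_psub ar \<rho> (gamma ar a))"
  using alpha_ren_psub gamma_ren_sharing assms(4) by blast

end
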